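(* No quiver in the mutation class of $X_7$ has an admissible vector.
   Context: $X_7$ is the quiver with vertices $v_0,v_1,\dots,v_6$ and arrows: double arrows $v_1\Rightarrow v_2$, $v_3\Rightarrow v_4$, $v_5\Rightarrow v_6$, and single arrows $v_0\to v_1$, $v_2\to v_0$, $v_0\to v_3$, $v_4\to v_0$, $v_0\to v_5$, $v_6\to v_0$ (three oriented triangles sharing $v_0$). Quivers have no loops/2-cycles; $b_{ij}$ is the number of arrows $v_i\to v_j$ (negative if reversed); mutation $\mu_k$: $b'_{ij}=-b_{ij}$ if $k\in\{i,j\}$, else $b'_{ij}=b_{ij}+\mathrm{sgn}(b_{ik})[b_{ik}b_{kj}]_+$. For a quiver $Q$ on mutable vertices and $\boldsymbol b$ an integer vector indexed by them, add a frozen vertex $q$ with $b_i$ arrows from $v_i$ to $q$; mutations only at mutable vertices. $\boldsymbol b$ is admissible if $\boldsymbol b\neq0$ and the resulting quiver with frozen vertex has finite mutation class. *)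

theory Defs
  imports Main
begin

text \<open>
  A quiver without loops and 2-cycles is represented by its skew-symmetric exchange matrix:
  \<open>B i j\<close> is the number of arrows from \<open>i\<close> to \<open>j\<close>, negative if the arrows go from \<open>j\<close> to \<open>i\<close>.
\<close>

type_synonym 'v quiver = "'v \<Rightarrow> 'v \<Rightarrow> int"

definition is_quiver :: "'v quiver \<Rightarrow> bool" where
  "is_quiver B \<longleftrightarrow> (\<forall>i j. B i j = - B j i)"

definition quiver_of_arrows :: "('v \<times> 'v) list \<Rightarrow> 'v quiver" where
  "quiver_of_arrows as i j = int (count_list as (i, j)) - int (count_list as (j, i))"

definition mutate :: "'v \<Rightarrow> 'v quiver \<Rightarrow> 'v quiver" where
  "mutate k B i j =
     (if k = i \<or> k = j then - B i j
      else B i j + sgn (B i k) * max 0 (B i k * B k j))"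

text \<open>Labelled mutation class, with mutations only at the vertices in \<open>M\<close>.\<close>

inductive_set mutation_class :: "'v set \<Rightarrow> 'v quiver \<Rightarrow> 'v quiver set"
  for M :: "'v set" and B :: "'v quiver" where
  base: "B \<in> mutation_class M B"
| step: "C \<in> mutation_class M B \<Longrightarrow> k \<in> M \<Longrightarrow> mutate k C \<in> mutation_class M B"

text \<open>In \<open>'v option\<close> the mutable vertices are \<open>Some v\<close> and the frozen vertex is \<open>None\<close>.\<close>

fun add_frozen :: "'v quiver \<Rightarrow> ('v \<Rightarrow> int) \<Rightarrow> 'v option quiver" where
  "add_frozen B b (Some i) (Some j) = B i j"
| "add_frozen B b (Some i) None = b i"
| "add_frozen B b None (Some j) = - b j"
| "add_frozen B b None None = 0"

definition admissible :: "'v quiver \<Rightarrow> ('v \<Rightarrow> int) \<Rightarrow> bool" where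
  "admissible B b \<longleftrightarrow>
     b \<noteq> (\<lambda>_. 0) \<and> finite (mutation_class (range Some) (add_frozen B b))"

datatype vertex = v0 | v1 | v2 | v3 | v4 | v5 | v6

definition X7 :: "vertex quiver" where
  "X7 = quiver_of_arrows
     [(v1, v2), (v1, v2), (v3, v4), (v3, v4), (v5, v6), (v5, v6),
      (v0, v1), (v2, v0), (v0, v3), (v4, v0), (v0, v5), (v6, v0)]"

lemma is_quiver_X7: "is_quiver X7"
  by (simp add: is_quiver_def X7_def quiver_of_arrows_def)

lemma is_quiver_mutate:
  assumes "is_quiver B"
  shows "is_quiver (mutate k B)"
  unfolding is_quiver_def
proof (intro allI)
  fix i j
  have 1: "B i j = - B j i" "B k i = - B i k" "B k j = - B j k"
    using assms unfolding is_quiver_def by blast+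
  have 2: "sgn a * max 0 (- (a * c)) = - (sgn c * max 0 (- (c * a)))" for a c :: int
    by (auto simp: sgn_if max_def mult_less_0_iff mult_le_0_iff)
  show "mutate k B i j = - mutate k B j i"
    using 2[of "B i k" "B j k"] 1 by (simp add: mutate_def)
qed

lemma is_quiver_mutation_class:
  "C \<in> mutation_class M B \<Longrightarrow> is_quiver B \<Longrightarrow> is_quiver C"
  by (induction rule: mutation_class.induct) (auto intro: is_quiver_mutate)

lemma is_quiver_add_frozen:
  assumes "is_quiver B"
  shows "is_quiver (add_frozen B b)"
  unfolding is_quiver_def
proof (intro allI)
  fix x y
  have skew: "B i j + B j i = 0" for i j
    using assms unfolding is_quiver_def by (metis add.left_inverse)
  have "add_frozen B b x y + add_frozen B b y x = 0"
    by (cases x; cases y) (simp_all add: skew)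
  then show "add_frozen B b x y = - add_frozen B b y x"
    by linarith
qed

end

theory Submission
  imports Defs
begin

text \<open>
  In a quiver of finite mutation type, mutating alternately at the ends of a double arrow
  \<open>u \<Rightarrow> w\<close> changes the numbers of arrows to any third vertex \<open>q\<close> linearly, and these stay
  bounded only if \<open>q \<rightarrow> u\<close> and \<open>w \<rightarrow> q\<close> with the same multiplicity \<open>a \<ge> 0\<close>. Hence an admissible
  vector of \<open>X\<^sub>7\<close> has the form \<open>(b\<^sub>0, -a, a, -c, c, -d, d)\<close> with \<open>a, c, d \<ge> 0\<close>.
  Mutating at \<open>v\<^sub>0, v\<^sub>3, v\<^sub>4\<close> yields a quiver with a double arrow \<open>v\<^sub>2 \<Rightarrow> v\<^sub>5\<close>
  in which \<open>v\<^sub>2\<close> has \<open>a + 2 [b\<^sub>0]\<^sub>+\<close> and \<open>v\<^sub>5\<close> has \<open>-d - 2 [-b\<^sub>0]\<^sub>+\<close> arrows to the frozen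
  vertex, so \<open>a = d = b\<^sub>0 = 0\<close>; by symmetry \<open>c = 0\<close>.
  Admissibility passes along mutations, so the whole mutation class is covered.
\<close>

lemma mutation_class_trans:
  assumes "D \<in> mutation_class M C" "C \<in> mutation_class M B"
  shows "D \<in> mutation_class M B"
  using assms by (induction rule: mutation_class.induct) (auto intro: mutation_class.step)

lemma mutate_in_mutation_class:
  "k \<in> M \<Longrightarrow> mutate k B \<in> mutation_class M B"
  by (intro mutation_class.step mutation_class.base)

lemma mutation_class_mutate_subset:
  "k \<in> M \<Longrightarrow> mutation_class M (mutate k B) \<subseteq> mutation_class M B"
  by (auto intro: mutation_class_trans mutate_in_mutation_class)

lemma finite_mutation_class_mutate:
  "finite (mutation_class M B) \<Longrightarrow> k \<in> M \<Longrightarrow> finite (mutation_class M (mutate k B))"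
  by (rule finite_subset[OF mutation_class_mutate_subset])

lemma is_quiver_skew: "is_quiver B \<Longrightarrow> B i j = - B j i"
  unfolding is_quiver_def by blast

lemma is_quiver_diag: "is_quiver B \<Longrightarrow> B i i = 0"
  using is_quiver_skew[of B i i] by simp

lemma mutate_mutate:
  assumes "is_quiver B"
  shows "mutate k (mutate k B) = B"
  using is_quiver_diag[OF assms, of k]
  by (intro ext) (auto simp: mutate_def sgn_minus)

lemma mutate_double_arrow:
  assumes "is_quiver C" "C u w = 2" "q \<noteq> u" "q \<noteq> w"
  shows "mutate u C w u = 2"
    and "mutate u C u q = - C u q"
    and "mutate u C w q = C w q - 2 * max 0 (- C u q)"
proof -
  have "C w u = - 2" "w \<noteq> u"
    using assms(2) is_quiver_skew[OF assms(1), of w u] is_quiver_diag[OF assms(1), of u]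
    by auto
  then show "mutate u C w u = 2" "mutate u C u q = - C u q"
    "mutate u C w q = C w q - 2 * max 0 (- C u q)"
    using assms by (auto simp: mutate_def max_def)
qed

context
  fixes M :: "'v set" and q :: 'v and N :: int
begin

text \<open>Finiteness enters only as a lower bound on the entries towards \<open>q\<close>. This
  form survives mutation at \<open>u\<close> with the two ends exchanged, so alternating mutations
  amount to swapping arguments.\<close>

definition double_arrow_bounded :: "'v quiver \<Rightarrow> 'v \<Rightarrow> 'v \<Rightarrow> bool" where
  "double_arrow_bounded C u w \<longleftrightarrow>
     is_quiver C \<and> C u w = 2 \<and> u \<in> M \<and> w \<in> M \<and> q \<noteq> u \<and> q \<noteq> w \<and>
     (\<forall>D \<in> mutation_class M C. - N < D u q \<and> - N < D w q)"

lemma double_arrow_bounded_mutate: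
  assumes "double_arrow_bounded C u w"
  shows "double_arrow_bounded (mutate u C) w u"
  using assms mutation_class_mutate_subset[of u M C]
  by (auto simp: double_arrow_bounded_def mutate_double_arrow(1) is_quiver_mutate)

lemma double_arrow_bounded_mutate_arrows:
  assumes "double_arrow_bounded C u w"
  shows "mutate u C u q = - C u q"
    and "mutate u C w q = C w q - 2 * max 0 (- C u q)"
  using assms mutate_double_arrow(2,3)[of C u w q] by (auto simp: double_arrow_bounded_def)

text \<open>Let x, y count the arrows from \<open>u\<close>, \<open>w\<close> to \<open>q\<close>.
  For x \<le> 0, mutating at \<open>u\<close> and exchanging the ends turns (x, y) into (2x + y,
  -x), with the same sum. If the sum were negative, the first entry would fall forever, against the
  bound \<open>- N\<close>.\<close>

lemma double_arrow_bounded_sum_nonneg: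
  assumes "double_arrow_bounded C u w" "C u q \<le> 0"
  shows "C u q + C w q \<ge> 0"
  using assms
proof (induction "nat (C u q + N)" arbitrary: C u w rule: less_induct)
  case less
  note arrows = double_arrow_bounded_mutate_arrows[OF less.prems(1)]
  have "- N < C u q"
    using less.prems(1) mutation_class.base[of C M] by (auto simp: double_arrow_bounded_def)
  then show ?case
    using less.hyps[OF _ double_arrow_bounded_mutate[OF less.prems(1)]] arrows less.prems(2)
    by (cases "C u q + C w q < 0") auto
qed

text \<open>Mutating at \<open>u\<close> and then at \<open>w\<close> negates both entries, and the
  sum of the results is still nonnegative.\<close>

lemma double_arrow_bounded_nonneg_imp_zero:
  assumes "double_arrow_bounded C u w" "C u q \<ge> 0" "C w q \<ge> 0"
  shows "C u q = 0 \<and> C w q = 0"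
proof -
  note bounded' = double_arrow_bounded_mutate[OF assms(1)]
  note arrows = double_arrow_bounded_mutate_arrows[OF assms(1)]
    double_arrow_bounded_mutate_arrows[OF bounded']
  show ?thesis
    using double_arrow_bounded_sum_nonneg[OF double_arrow_bounded_mutate[OF bounded']]
      arrows assms(2,3) by auto
qed

lemma double_arrow_bounded_nonpos:
  assumes "double_arrow_bounded C u w"
  shows "C u q \<le> 0"
proof (rule ccontr)
  assume pos: "\<not> C u q \<le> 0"
  show False
  proof (cases "C w q \<ge> 0")
    case True
    then show False
      using double_arrow_bounded_nonneg_imp_zero[OF assms] pos by auto
  next
    case False
    \<comment> \<open>Mutating at \<open>u\<close> makes both entries negative.\<close>
    then show False
      using double_arrow_bounded_sum_nonneg[OF double_arrow_bounded_mutate[OF assms]]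
        double_arrow_bounded_mutate_arrows[OF assms] pos by auto
  qed
qed

text \<open>If the sum were positive, the same mutation would strictly raise a negative first entry
  while keeping it \<le> 0 and the sum fixed; this descent ends at first entry 0, where both entries
  vanish.\<close>

lemma double_arrow_bounded_sum_zero:
  assumes "double_arrow_bounded C u w"
  shows "C u q + C w q = 0"
  using assms
proof (induction "nat (- C u q)" arbitrary: C u w rule: less_induct)
  case less
  note bounded' = double_arrow_bounded_mutate[OF less.prems]
  have x: "C u q \<le> 0" "C u q + C w q \<ge> 0" "mutate u C w q \<le> 0"
    using double_arrow_bounded_nonpos[OF less.prems] double_arrow_bounded_nonpos[OF bounded']
      double_arrow_bounded_sum_nonneg[OF less.prems] by auto
  show ?case
  proof (cases "C u q = 0")
    case True
    then show ?thesis
      using double_arrow_bounded_nonneg_imp_zero[OF less.prems] x by auto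
  next
    case False
    then show ?thesis
      using less.hyps[OF _ bounded'] x double_arrow_bounded_mutate_arrows[OF less.prems]
      by (cases "C u q + C w q > 0") auto
  qed
qed

end

lemma double_arrow_finite_mutation_class:
  assumes "finite (mutation_class M C)" "is_quiver C" "C u w = 2"
    and "u \<in> M" "w \<in> M" "q \<noteq> u" "q \<noteq> w"
  shows "C u q \<le> 0" and "C w q = - C u q"
proof -
  let ?S = "(\<lambda>D. \<bar>D u q\<bar>) ` mutation_class M C \<union> (\<lambda>D. \<bar>D w q\<bar>) ` mutation_class M C"
  have "\<bar>D u q\<bar> \<le> Max ?S" "\<bar>D w q\<bar> \<le> Max ?S" if "D \<in> mutation_class M C" for D
    using that assms(1) by (auto intro!: Max_ge)
  \<comment> \<open>The added 1 makes the bound strict.\<close>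
  then have "double_arrow_bounded M q (Max ?S + 1) C u w"
    using assms(2-) by (fastforce simp: double_arrow_bounded_def)
  from double_arrow_bounded_nonpos[OF this] double_arrow_bounded_sum_zero[OF this]
  show "C u q \<le> 0" "C w q = - C u q" by auto
qed

definition mutate_frozen :: "'v \<Rightarrow> 'v quiver \<Rightarrow> ('v \<Rightarrow> int) \<Rightarrow> 'v \<Rightarrow> int" where
  "mutate_frozen k B b i =
     (if i = k then - b i else b i + sgn (B i k) * max 0 (B i k * b k))"

lemma mutate_add_frozen:
  assumes "is_quiver B"
  shows "mutate (Some k) (add_frozen B b) = add_frozen (mutate k B) (mutate_frozen k B b)"
proof (intro ext)
  fix x y
  have "B k j = - B j k" for j
    using is_quiver_skew[OF assms] .
  then show "mutate (Some k) (add_frozen B b) x y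
      = add_frozen (mutate k B) (mutate_frozen k B b) x y"
    by (cases x; cases y)
      (auto simp: mutate_def mutate_frozen_def sgn_if max_def mult_less_0_iff mult_le_0_iff
        zero_less_mult_iff zero_le_mult_iff)
qed

lemma admissible_mutate_frozen:
  assumes "is_quiver B" "admissible B b"
  shows "admissible (mutate k B) (mutate_frozen k B b)"
proof -
  \<comment> \<open>The entry at \<open>k\<close> gives \<open>b k = 0\<close>, which kills every
    correction term.\<close>
  have "b = (\<lambda>_. 0)" if zero: "mutate_frozen k B b = (\<lambda>_. 0)"
  proof
    fix i
    show "b i = 0"
      using fun_cong[OF zero, of k] fun_cong[OF zero, of i]
      by (auto simp: mutate_frozen_def split: if_splits)
  qed
  then show ?thesis
    using assms finite_mutation_class_mutate[of "range Some" "add_frozen B b" "Some k"]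
    by (auto simp: admissible_def mutate_add_frozen)
qed

lemma X7_not_admissible: "\<not> admissible X7 b"
proof
  assume adm: "admissible X7 b"
  define C where "C = add_frozen X7 b"
  have C: "is_quiver C" "finite (mutation_class (range Some) C)"
    using adm by (auto simp: C_def admissible_def is_quiver_add_frozen is_quiver_X7)
  note X7_simps = C_def mutate_def X7_def quiver_of_arrows_def
  have "C (Some v1) (Some v2) = 2" "C (Some v3) (Some v4) = 2" "C (Some v5) (Some v6) = 2"
    by (simp_all add: X7_simps)
  note arrows = this[THEN double_arrow_finite_mutation_class(1)[OF C(2,1), where q = None]]
    this[THEN double_arrow_finite_mutation_class(2)[OF C(2,1), where q = None]]
  have b: "b v1 \<le> 0" "b v2 = - b v1" "b v3 \<le> 0" "b v4 = - b v3" "b v5 \<le> 0" "b v6 = - b v5"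
    using arrows by (auto simp: C_def)

  define D where "D = mutate (Some v4) (mutate (Some v3) (mutate (Some v0) C))"
  have D: "is_quiver D" "finite (mutation_class (range Some) D)"
    using C by (simp_all add: D_def is_quiver_mutate finite_mutation_class_mutate)
  have D25: "D (Some v2) (Some v5) = 2"
    by (simp add: D_def X7_simps)
  have "D (Some v2) None = - b v1 + 2 * max 0 (b v0)"
    "D (Some v5) None = b v5 - 2 * max 0 (- b v0)"
    using b by (auto simp: D_def X7_simps max_def)
  \<comment> \<open>The entry at \<open>v2\<close> is a sum of nonnegative terms yet \<le> 0, so it
    vanishes; then so does the entry at \<open>v5\<close>, a sum of nonpositive terms.\<close>
  then have "b v0 = 0" "b v1 = 0" "b v5 = 0"
    using double_arrow_finite_mutation_class[OF D(2,1) D25, of None] b by auto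

  \<comment> \<open>This is \<open>D\<close> with the triangles through \<open>v1\<close>,
    \<open>v2\<close> and through \<open>v3\<close>, \<open>v4\<close> exchanged.\<close>
  define E where "E = mutate (Some v2) (mutate (Some v1) (mutate (Some v0) C))"
  have E: "is_quiver E" "finite (mutation_class (range Some) E)"
    using C by (simp_all add: E_def is_quiver_mutate finite_mutation_class_mutate)
  have E45: "E (Some v4) (Some v5) = 2"
    by (simp add: E_def X7_simps)
  have "E (Some v4) None = - b v3 + 2 * max 0 (b v0)"
    using b by (auto simp: E_def X7_simps max_def)
  then have "b v3 = 0"
    using double_arrow_finite_mutation_class(1)[OF E(2,1) E45, of None] b by auto

  have "b i = 0" for i
    using b \<open>b v0 = 0\<close> \<open>b v1 = 0\<close> \<open>b v3 = 0\<close> \<open>b v5 = 0\<close> by (cases i) auto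
  then show False
    using adm by (auto simp: admissible_def)
qed

theorem theorem6p1:
  fixes Q :: "vertex quiver"
  assumes "Q \<in> mutation_class UNIV X7"
  shows "\<not> (\<exists>b :: vertex \<Rightarrow> int. admissible Q b)"
  using assms
proof (induction rule: mutation_class.induct)
  case base
  then show ?case
    by (simp add: X7_not_admissible)
next
  case (step C k)
  have "is_quiver C"
    using is_quiver_mutation_class[OF step.hyps(1) is_quiver_X7] .
  \<comment> \<open>Mutation at \<open>k\<close> is an involution, so an admissible vector of
    \<open>mutate k C\<close> would yield one of \<open>C\<close>.\<close>
  then show ?case
    using step.IH admissible_mutate_frozen[of "mutate k C" _ k]
    by (auto simp: is_quiver_mutate mutate_mutate)
qed

end
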